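(* Let $\mathbb{A}=(A,(\mathrm{Con}_i)_{i\in A},(\vDash_i)_{i\in A})$ be a continuous information frame. Define $\widetilde A=\bigcup_{a\in A}\{a\}\times\mathrm{Con}_a$; for $(a,X)\in\widetilde A$ let $\widetilde{\mathrm{Con}}_{(a,X)}=\{\{(a,X)\}\}\cup\{\mathfrak Y\subseteq\widetilde A\text{ finite}:(\forall (b,Y)\in\mathfrak Y)\ X\vDash_a\{b\}\cup Y\}$, and for $\mathfrak X\in\widetilde{\mathrm{Con}}_{(a,X)}$ and $(e,V)\in\widetilde A$ let $\mathfrak X\mathrel{\widetilde\vDash}_{(a,X)}(e,V)$ iff there is $(c,Z)\in\mathfrak X\cup\{(a,X)\}$ with $Z\vDash_c\{e\}\cup V$. Then $\mathcal T(\mathbb A)=(\widetilde A,(\widetilde{\mathrm{Con}}_x)_{x\in\widetilde A},(\mathrel{\widetilde\vDash}_x)_{x\in\widetilde A})$ is a strong continuous information frame.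
   Context: A continuous information frame is a triple $\mathbb{A}=(A,(\mathrm{Con}_i)_{i\in A},(\vDash_i)_{i\in A})$ where $A$ is a set, each $\mathrm{Con}_i$ is a set of finite subsets of $A$, and $\vDash_i\subseteq\mathrm{Con}_i\times A$; write $iRj$ iff $\{i\}\in\mathrm{Con}_j$, and for finite $Y$, $X\vDash_i Y$ iff $X\vDash_i b$ for all $b\in Y$. Required, for all $i,j,a\in A$ and finite $X,Y\subseteq A$: (i) $\{i\}\in\mathrm{Con}_i$; (ii) if $Y\subseteq X\in\mathrm{Con}_i$ then $Y\in\mathrm{Con}_i$; (iii) if $X\in\mathrm{Con}_i$ and $X\vDash_i Y$ then $Y\in\mathrm{Con}_i$; (iv) if $X,Y\in\mathrm{Con}_i$, $X\subseteq Y$ and $X\vDash_i a$ then $Y\vDash_i a$; (v) if $X\in\mathrm{Con}_i$, $X\vDash_i Y$ and $Y\vDash_i a$ then $X\vDash_i a$; (vi) if $iRj$ then $\mathrm{Con}_i\subseteq\mathrm{Con}_j$; (vii) if $iRj$, $X\in\mathrm{Con}_i$ and $X\vDash_i a$ then $X\vDash_j a$; (viii) if $X\vDash_i Y$ then there exist $e\in A$ and $Z\in\mathrm{Con}_e$ with $X\vDash_i \{e\}\cup Z$ and $Z\vDash_e Y$. (The same definition applies to frames whose token set is $\widetilde A$.) The frame is strong if for every token $i$ and every $X\in\mathrm{Con}_i$ with $X\neq\{i\}$ we have $\{i\}\vDash_i X$. *)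

theory Defs
  imports Main
begin

text \<open>
  The tokens form a carrier set \<open>A\<close>; the families \<open>Con\<close> and \<open>ent\<close> are total functions on the
  type, constrained only at indices in \<open>A\<close>.
\<close>

definition entails_set :: "('a \<Rightarrow> ('a set \<times> 'a) set) \<Rightarrow> 'a \<Rightarrow> 'a set \<Rightarrow> 'a set \<Rightarrow> bool" where
  "entails_set ent i X Y \<longleftrightarrow> (\<forall>b\<in>Y. (X, b) \<in> ent i)"

definition frame_rel :: "('a \<Rightarrow> 'a set set) \<Rightarrow> 'a \<Rightarrow> 'a \<Rightarrow> bool" where
  "frame_rel Con i j \<longleftrightarrow> {i} \<in> Con j"

text \<open>
  Since \<open>entails_set ent i X {}\<close> holds vacuously for every \<open>X\<close>, the interpolation axiom carries the
  premise \<open>X \<in> Con i\<close> explicitly: without it, the case \<open>Y = {}\<close> would force every finite subset of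
  \<open>A\<close> to be consistent. For nonempty \<open>Y\<close> the premise is redundant by \<open>ent_subset\<close>.
\<close>

locale continuous_information_frame =
  fixes A :: "'a set"
    and Con :: "'a \<Rightarrow> 'a set set"
    and ent :: "'a \<Rightarrow> ('a set \<times> 'a) set"
  assumes Con_subset: "i \<in> A \<Longrightarrow> Con i \<subseteq> Fpow A"
    and ent_subset: "i \<in> A \<Longrightarrow> ent i \<subseteq> Con i \<times> A"
    and self_consistent: "i \<in> A \<Longrightarrow> {i} \<in> Con i"
    and Con_downward:
      "\<lbrakk>i \<in> A; X \<in> Fpow A; Y \<in> Fpow A; Y \<subseteq> X; X \<in> Con i\<rbrakk> \<Longrightarrow> Y \<in> Con i"
    and Con_entailed:
      "\<lbrakk>i \<in> A; X \<in> Fpow A; Y \<in> Fpow A; X \<in> Con i; entails_set ent i X Y\<rbrakk> \<Longrightarrow> Y \<in> Con i"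
    and ent_mono:
      "\<lbrakk>i \<in> A; a \<in> A; X \<in> Fpow A; Y \<in> Fpow A; X \<in> Con i; Y \<in> Con i; X \<subseteq> Y; (X, a) \<in> ent i\<rbrakk>
        \<Longrightarrow> (Y, a) \<in> ent i"
    and ent_cut:
      "\<lbrakk>i \<in> A; a \<in> A; X \<in> Fpow A; Y \<in> Fpow A; X \<in> Con i; entails_set ent i X Y; (Y, a) \<in> ent i\<rbrakk>
        \<Longrightarrow> (X, a) \<in> ent i"
    and Con_rel: "\<lbrakk>i \<in> A; j \<in> A; frame_rel Con i j\<rbrakk> \<Longrightarrow> Con i \<subseteq> Con j"
    and ent_rel:
      "\<lbrakk>i \<in> A; j \<in> A; a \<in> A; X \<in> Fpow A; frame_rel Con i j; X \<in> Con i; (X, a) \<in> ent i\<rbrakk>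
        \<Longrightarrow> (X, a) \<in> ent j"
    and ent_interpolation:
      "\<lbrakk>i \<in> A; X \<in> Fpow A; Y \<in> Fpow A; X \<in> Con i; entails_set ent i X Y\<rbrakk>
        \<Longrightarrow> \<exists>e\<in>A. \<exists>Z\<in>Con e. entails_set ent i X ({e} \<union> Z) \<and> entails_set ent e Z Y"

locale strong_continuous_information_frame = continuous_information_frame +
  assumes strong: "\<lbrakk>i \<in> A; X \<in> Con i; X \<noteq> {i}\<rbrakk> \<Longrightarrow> entails_set ent i {i} X"

definition tilde_tokens :: "'a set \<Rightarrow> ('a \<Rightarrow> 'a set set) \<Rightarrow> ('a \<times> 'a set) set" where
  "tilde_tokens A Con = (\<Union>a\<in>A. {a} \<times> Con a)"

definition tilde_Con ::
  "'a set \<Rightarrow> ('a \<Rightarrow> 'a set set) \<Rightarrow> ('a \<Rightarrow> ('a set \<times> 'a) set)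
    \<Rightarrow> 'a \<times> 'a set \<Rightarrow> ('a \<times> 'a set) set set" where
  "tilde_Con A Con ent = (\<lambda>(a, X).
     {{(a, X)}} \<union>
     {YY. YY \<subseteq> tilde_tokens A Con \<and> finite YY \<and>
          (\<forall>(b, Y)\<in>YY. entails_set ent a X ({b} \<union> Y))})"

definition tilde_ent ::
  "'a set \<Rightarrow> ('a \<Rightarrow> 'a set set) \<Rightarrow> ('a \<Rightarrow> ('a set \<times> 'a) set)
    \<Rightarrow> 'a \<times> 'a set \<Rightarrow> (('a \<times> 'a set) set \<times> ('a \<times> 'a set)) set" where
  "tilde_ent A Con ent = (\<lambda>(a, X).
     {(XX, (e, V)). XX \<in> tilde_Con A Con ent (a, X) \<and> (e, V) \<in> tilde_tokens A Con \<and>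
        (\<exists>(c, Z)\<in>XX \<union> {(a, X)}. entails_set ent c Z ({e} \<union> V))})"

end

theory Submission
  imports Defs
begin

text \<open>
  Write \<open>(a, X) \<succ> (b, Y)\<close> for \<open>entails_set ent a X ({b} \<union> Y)\<close>. This relation is transitive, and it
  interpolates finite sets because the given frame does. Transitivity makes the choice of \<open>(c, Z)\<close>
  in the definition of the new entailment immaterial: a set consistent at \<open>p\<close> entails \<open>q\<close> at \<open>p\<close>
  iff \<open>p \<succ> q\<close>. Any transitive relation with finite interpolation yields a strong frame in this way.
\<close>

lemma strong_frame_of_interpolating_relation:
  assumes Con: "\<And>p. p \<in> T \<Longrightarrow> Con p = insert {p} {Q. finite Q \<and> Q \<subseteq> T \<and> (\<forall>q\<in>Q. R p q)}"
    and ent: "\<And>p. p \<in> T \<Longrightarrow> ent p = Con p \<times> {q \<in> T. R p q}"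
    and trans: "\<And>p q r. \<lbrakk>p \<in> T; q \<in> T; r \<in> T; R p q; R q r\<rbrakk> \<Longrightarrow> R p r"
    and interpolation:
      "\<And>p Q. \<lbrakk>p \<in> T; finite Q; Q \<subseteq> T; \<forall>q\<in>Q. R p q\<rbrakk> \<Longrightarrow> \<exists>r\<in>T. R p r \<and> (\<forall>q\<in>Q. R r q)"
  shows "strong_continuous_information_frame T Con ent"
proof unfold_locales
  fix i assume i: "i \<in> T"
  show "Con i \<subseteq> Fpow T" using i by (auto simp: Con Fpow_def)
  show "ent i \<subseteq> Con i \<times> T" using i by (auto simp: ent)
  show "{i} \<in> Con i" using i by (simp add: Con)
  \<comment> \<open>Below the exceptional set \<open>{i}\<close> lie only \<open>{}\<close> and
    \<open>{i}\<close>; both are consistent at \<open>i\<close> even if \<open>R i i\<close>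
    fails.\<close>
  show "Y \<in> Con i" if "Y \<subseteq> X" "X \<in> Con i" for X Y
    using that i by (auto simp: Con subset_singleton_iff dest: finite_subset)
  show "Y \<in> Con i" if "Y \<in> Fpow T" "entails_set ent i X Y" for X Y
    using that i by (auto simp: Con ent Fpow_def entails_set_def)
  \<comment> \<open>\<open>ent i\<close> is a product, so what is entailed at \<open>i\<close> is
    the same for every consistent set.\<close>
  show "(Y, a) \<in> ent i" if "Y \<in> Con i" "(X, a) \<in> ent i" for X Y a
    using that i by (simp add: ent)
  show "(X, a) \<in> ent i" if "X \<in> Con i" "(Y, a) \<in> ent i" for X Y a
    using that i by (simp add: ent)
  \<comment> \<open>Apart from \<open>{i}\<close>, every member of \<open>Con i\<close> consists of
    \<open>R\<close>-successors of \<open>i\<close>.\<close>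
  show "entails_set ent i {i} X" if "X \<in> Con i" "X \<noteq> {i}" for X
    using that i by (auto simp: Con ent entails_set_def)
  show "\<exists>e\<in>T. \<exists>Z\<in>Con e. entails_set ent i X ({e} \<union> Z) \<and> entails_set ent e Z Y"
    if "Y \<in> Fpow T" "X \<in> Con i" "entails_set ent i X Y" for X Y
  proof -
    have Y: "finite Y" "Y \<subseteq> T" "\<forall>q\<in>Y. R i q"
      using that i by (auto simp: Fpow_def entails_set_def ent)
    obtain r where "r \<in> T" "R i r" "\<forall>q\<in>Y. R r q"
      using interpolation[OF i Y] by blast
    \<comment> \<open>The interpolant \<open>r\<close> serves both as the new index and, through
      \<open>{r}\<close>, as the new consistent set.\<close>
    then show ?thesis
      using that(2) i Y(2) by (intro bexI[of _ r] bexI[of _ "{r}"]) (auto simp: entails_set_def ent Con)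
  qed
next
  fix i j assume ij: "i \<in> T" "j \<in> T" "frame_rel Con i j"
  \<comment> \<open>\<open>{i}\<close> lies in \<open>Con j\<close> either as the exceptional
    singleton or as a set of successors of \<open>j\<close>. In the second case transitivity carries
    the successors of \<open>i\<close> over to \<open>j\<close>.\<close>
  then have rel: "i = j \<or> R j i"
    by (auto simp: frame_rel_def Con)
  show Con_le: "Con i \<subseteq> Con j"
    using rel
  proof
    assume "R j i"
    then show ?thesis
      using ij(1,2) by (auto simp: Con intro: trans[of j i])
  qed simp
  show "(X, a) \<in> ent j" if "X \<in> Con i" "(X, a) \<in> ent i" for X a
    using rel
  proof
    assume "R j i"
    then show ?thesis
      using that Con_le ij(1,2) by (auto simp: ent intro: trans[of j i])
  qed (use that in simp)
qed

context continuous_information_frame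
begin

text \<open>Entailing \<open>c\<close> at \<open>a\<close> makes \<open>{c}\<close> consistent at
  \<open>a\<close>. Hence entailments at \<open>c\<close> persist at \<open>a\<close>, where cutting
  through \<open>Z\<close> applies. With \<open>V\<close> of the form \<open>{e} \<union> Y\<close>
  this is transitivity of \<open>\<succ>\<close>.\<close>

lemma entails_set_trans:
  assumes "a \<in> A" "c \<in> A" "X \<in> Con a" "Z \<in> Con c"
    and XZ: "entails_set ent a X ({c} \<union> Z)" and ZV: "entails_set ent c Z V"
  shows "entails_set ent a X V"
proof -
  have X: "X \<in> Fpow A" and Z: "Z \<in> Fpow A"
    using assms Con_subset by auto
  have "{c} \<in> Con a"
    using Con_entailed[of a X "{c}"] XZ assms X by (auto simp: entails_set_def Fpow_def)
  then have rel: "frame_rel Con c a"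
    by (simp add: frame_rel_def)
  have XZ': "entails_set ent a X Z"
    using XZ by (simp add: entails_set_def)
  show ?thesis
    unfolding entails_set_def
  proof
    fix v assume "v \<in> V"
    then have v: "(Z, v) \<in> ent c" "v \<in> A"
      using ZV ent_subset[OF \<open>c \<in> A\<close>] by (auto simp: entails_set_def)
    have "(Z, v) \<in> ent a"
      using ent_rel[OF \<open>c \<in> A\<close> \<open>a \<in> A\<close> v(2) Z rel \<open>Z \<in> Con c\<close> v(1)] .
    then show "(X, v) \<in> ent a"
      using ent_cut[OF \<open>a \<in> A\<close> v(2) X Z \<open>X \<in> Con a\<close> XZ'] by simp
  qed
qed

text \<open>A pair chosen from \<open>XX\<close> is either \<open>(a, X)\<close> itself or below it
  under \<open>\<succ>\<close>, so transitivity passes its consequences to \<open>(a, X)\<close>.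
  Conversely, \<open>(a, X)\<close> is always an admissible choice.\<close>

lemma tilde_ent_eq:
  assumes "(a, X) \<in> tilde_tokens A Con"
  shows "tilde_ent A Con ent (a, X) =
    tilde_Con A Con ent (a, X) \<times> {(e, V) \<in> tilde_tokens A Con. entails_set ent a X ({e} \<union> V)}"
proof -
  have reduce: "entails_set ent a X ({e} \<union> V)"
    if XX: "XX \<in> tilde_Con A Con ent (a, X)" and cZ: "(c, Z) \<in> XX \<union> {(a, X)}"
      and e: "entails_set ent c Z ({e} \<union> V)" for XX c Z e V
  proof (cases "(c, Z) = (a, X)")
    case False
    then have "(c, Z) \<in> tilde_tokens A Con" "entails_set ent a X ({c} \<union> Z)"
      using XX cZ by (auto simp: tilde_Con_def)
    then show ?thesis
      using assms e entails_set_trans[of a c X Z "{e} \<union> V"] by (simp add: tilde_tokens_def)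
  qed (use e in simp)
  have "(\<exists>(c, Z)\<in>XX \<union> {(a, X)}. entails_set ent c Z ({e} \<union> V)) \<longleftrightarrow>
      entails_set ent a X ({e} \<union> V)"
    if "XX \<in> tilde_Con A Con ent (a, X)" for XX e V
    using reduce[OF that] by blast
  then show ?thesis
    unfolding tilde_ent_def by (simp add: set_eq_iff cong: conj_cong)
qed

lemma tilde_interpolation:
  assumes aX: "(a, X) \<in> tilde_tokens A Con" and "finite Q" and Q: "Q \<subseteq> tilde_tokens A Con"
    and ent_Q: "\<forall>(b, Y)\<in>Q. entails_set ent a X ({b} \<union> Y)"
  shows "\<exists>(e, Z)\<in>tilde_tokens A Con. entails_set ent a X ({e} \<union> Z) \<and>
    (\<forall>(b, Y)\<in>Q. entails_set ent e Z ({b} \<union> Y))"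
proof -
  \<comment> \<open>Flattening \<open>Q\<close> to a finite set of old tokens turns the separate
    conditions on its pairs into one entailment, to which \<open>ent_interpolation\<close> applies;
    its \<open>e\<close> and \<open>Z\<close> form the new token.\<close>
  define W where "W = (\<Union>(b, Y)\<in>Q. {b} \<union> Y)"
  have a: "a \<in> A" "X \<in> Con a"
    using aX by (auto simp: tilde_tokens_def)
  have "{b} \<union> Y \<in> Fpow A" if "(b, Y) \<in> Q" for b Y
    using that Q Con_subset[of b] by (auto simp: Fpow_def tilde_tokens_def)
  then have "W \<in> Fpow A"
    using \<open>finite Q\<close> unfolding W_def Fpow_def by (auto split: prod.splits)
  moreover have "entails_set ent a X W"
    using ent_Q unfolding W_def entails_set_def by blast
  ultimately obtain e Z where "e \<in> A" "Z \<in> Con e"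
      "entails_set ent a X ({e} \<union> Z)" "entails_set ent e Z W"
    using ent_interpolation[of a X W] a Con_subset by blast
  moreover have "entails_set ent e Z ({b} \<union> Y)" if "(b, Y) \<in> Q" for b Y
    using that \<open>entails_set ent e Z W\<close> unfolding W_def entails_set_def by blast
  ultimately show ?thesis
    by (intro bexI[of _ "(e, Z)"]) (auto simp: tilde_tokens_def)
qed

end

theorem theorem5p1:
  fixes A :: "'a set"
    and Con :: "'a \<Rightarrow> 'a set set"
    and ent :: "'a \<Rightarrow> ('a set \<times> 'a) set"
  assumes "continuous_information_frame A Con ent"
  shows "strong_continuous_information_frame
    (tilde_tokens A Con) (tilde_Con A Con ent) (tilde_ent A Con ent)"
proof -
  interpret continuous_information_frame A Con ent by (fact assms)
  let ?R = "\<lambda>(a, X) (b, Y). entails_set ent a X ({b} \<union> Y)"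
  show ?thesis
  proof (rule strong_frame_of_interpolating_relation[where R = ?R])
    show "tilde_Con A Con ent p =
        insert {p} {Q. finite Q \<and> Q \<subseteq> tilde_tokens A Con \<and> (\<forall>q\<in>Q. ?R p q)}" for p
      by (auto simp: tilde_Con_def split: prod.split)
    show "tilde_ent A Con ent p = tilde_Con A Con ent p \<times> {q \<in> tilde_tokens A Con. ?R p q}"
      if "p \<in> tilde_tokens A Con" for p
      using that by (cases p) (auto simp: tilde_ent_eq)
    \<comment> \<open>The set \<open>V\<close> of \<open>entails_set_trans\<close> is here
      \<open>{fst r} \<union> snd r\<close>.\<close>
    show "?R p r" if "p \<in> tilde_tokens A Con" "q \<in> tilde_tokens A Con" "?R p q" "?R q r" for p q r
      using that entails_set_trans[of "fst p" "fst q" "snd p" "snd q"]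
      by (auto simp: tilde_tokens_def)
    show "\<exists>r\<in>tilde_tokens A Con. ?R p r \<and> (\<forall>q\<in>Q. ?R r q)"
      if "p \<in> tilde_tokens A Con" "finite Q" "Q \<subseteq> tilde_tokens A Con" "\<forall>q\<in>Q. ?R p q" for p Q
      using tilde_interpolation[of "fst p" "snd p" Q] that by (simp add: case_prod_unfold)
  qed
qed

end
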